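(* Let $m>1$, let $X\ne\emptyset$ be a finite set, let $k:X\times X\to[0,\infty)$ be symmetric and such that the induced graph with vertex set $X$ is connected, and let $L$ be the operator generated by $k$. Suppose that $L$ satisfies the condition $CD_{m,\alpha}(0,d)$ with some $d>0$ and $\alpha\in[0,1)$. Let $u:[0,\infty)\times X\to(0,\infty)$ be a solution of the porous medium equation $\partial_t u-Lu^m=0$ on $(0,\infty)\times X$, let $v=\frac{m}{m-1}u^{m-1}$, and put $\mu=(m-1)d$. Let $0<t_1<t_2$ and $x_1,x_2\in X$. Then for any sequence of pairwise distinct points $(y_i)_{i=0,1,\dots,N}$ in $X$, $N\in\mathbb{N}$, such that $y_0=x_1$, $y_N=x_2$ and $k(y_{i-1},y_i)>0$ for $i\in\{1,\dots,N\}$, there holds $$t_1^\mu v(t_1,x_1)\le t_2^\mu v(t_2,x_2)+\frac{2N^2}{(1-\alpha)(\mu+1)(t_2-t_1)^2}\sum_{j=1}^N\frac{\tau_j^{\mu+1}-\tau_{j-1}^{\mu+1}}{k(y_{j-1},y_j)},$$ where $\tau_i=t_1+i\frac{t_2-t_1}{N}$, $i=0,1,\dots,N$. Moreover, $$t_1^\mu v(t_1,x_1)\le t_2^\mu v(t_2,x_2)+\frac{2\,\mathrm{dist}(x_1,x_2)^2\,(t_2^{\mu+1}-t_1^{\mu+1})}{(1-\alpha)(\mu+1)\,k_{\min}\,(t_2-t_1)^2},$$ where $k_{\min}$ is the minimal positive weight of an edge, i.e. the minimum of the positive values of $k$ on $X\times X$.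
   Context: $k$ is assumed nontrivial with $k(x,x)=0$. The graph induced by $k$ has vertex set $X$, and $x,y$ are joined by an edge if and only if $k(x,y)>0$; the weight of that edge is $k(x,y)$. For $x_1,x_2\in X$, $\mathrm{dist}(x_1,x_2)$ denotes the minimal length of all paths connecting $x_1$ and $x_2$ in the graph, where the length of a path is its number of edges. $L$ is given by $Lf(x)=\sum_{y\in X}k(x,y)(f(y)-f(x))$. A solution of the porous medium equation is differentiable in $t$ and satisfies the equation pointwise on $(0,\infty)\times X$. For $w:X\to(0,\infty)$ and $m>1$, $$\tilde{\Psi}_\Upsilon^{(m)}(w)(x)=\sum_{y\in X}k(x,y)\Big(\tfrac{m-1}{m}w(x)^2+\tfrac{(m-1)^2}{m}w(x)^{\frac{m-2}{m-1}}w(y)^{\frac{m}{m-1}}-(m-1)w(x)w(y)\Big).$$ For $u:X\to(0,\infty)$, $m>1$ and $\alpha\in[0,1]$, $$\mathcal{D}_{m,\alpha}(u)(x)=\sum_{y\in X}k(x,y)\Big(\Big(1-\alpha+\alpha\tfrac{u(y)}{u(x)}\Big)m\,u^{m-2}(y)Lu^m(y)-\Big(m-\alpha+\alpha\big(\tfrac{u(y)}{u(x)}\big)^m\Big)u^{m-2}(x)Lu^m(x)\Big).$$ Condition $CD_{m,\alpha}(0,d)$ at $x\in X$: for every $u:X\to(0,\infty)$, with $v=\frac{m}{m-1}u^{m-1}$ and $G=Lv+\alpha\frac{\tilde{\Psi}_\Upsilon^{(m)}(v)}{(m-1)v}$, such that $-G(x)>0$ and $-G(x)\ge -G(y)$ for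 all $y\in X$ with $k(x,y)>0$, one has $$\mathcal{D}_{m,\alpha}(u)(x)\ge\frac1d\big(-G(x)\big)^2.$$ $L$ satisfies $CD_{m,\alpha}(0,d)$ if it satisfies it at every $x\in X$. Here $\mathbb{N}=\{1,2,\dots\}$. *)

theory Defs
  imports Complex_Main "Graph_Theory.Digraph_Component"
begin

text \<open>
  Throughout, \<open>X\<close> is the vertex set and \<open>k\<close> the kernel; only the values of functions on \<open>X\<close>
  matter. Real powers of positive quantities are written with \<open>powr\<close>.
\<close>

text \<open>For symmetric \<open>k\<close> an undirected edge is represented by its two opposite arcs.\<close>

definition induced_graph :: "'a set \<Rightarrow> ('a \<Rightarrow> 'a \<Rightarrow> real) \<Rightarrow> ('a, 'a \<times> 'a) pre_digraph" where
  "induced_graph X k = with_proj \<lparr> pverts = X, parcs = {(x, y). x \<in> X \<and> y \<in> X \<and> k x y > 0} \<rparr>"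

definition graph_dist :: "'a set \<Rightarrow> ('a \<Rightarrow> 'a \<Rightarrow> real) \<Rightarrow> 'a \<Rightarrow> 'a \<Rightarrow> nat" where
  "graph_dist X k x y =
     (LEAST n. \<exists>p. pre_digraph.apath (induced_graph X k) x p y \<and> length p = n)"

definition min_weight :: "'a set \<Rightarrow> ('a \<Rightarrow> 'a \<Rightarrow> real) \<Rightarrow> real" where
  "min_weight X k = Min {k x y | x y. x \<in> X \<and> y \<in> X \<and> k x y > 0}"

definition laplacian :: "'a set \<Rightarrow> ('a \<Rightarrow> 'a \<Rightarrow> real) \<Rightarrow> ('a \<Rightarrow> real) \<Rightarrow> 'a \<Rightarrow> real" where
  "laplacian X k f x = (\<Sum>y\<in>X. k x y * (f y - f x))"

definition pressure :: "real \<Rightarrow> ('a \<Rightarrow> real) \<Rightarrow> 'a \<Rightarrow> real" where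
  "pressure m u x = m / (m - 1) * u x powr (m - 1)"

definition Psi_tilde ::
  "'a set \<Rightarrow> ('a \<Rightarrow> 'a \<Rightarrow> real) \<Rightarrow> real \<Rightarrow> ('a \<Rightarrow> real) \<Rightarrow> 'a \<Rightarrow> real" where
  "Psi_tilde X k m w x = (\<Sum>y\<in>X. k x y *
     ((m - 1) / m * (w x)^2
      + (m - 1)^2 / m * w x powr ((m - 2) / (m - 1)) * w y powr (m / (m - 1))
      - (m - 1) * w x * w y))"

definition D_op ::
  "'a set \<Rightarrow> ('a \<Rightarrow> 'a \<Rightarrow> real) \<Rightarrow> real \<Rightarrow> real \<Rightarrow> ('a \<Rightarrow> real) \<Rightarrow> 'a \<Rightarrow> real" where
  "D_op X k m \<alpha> u x = (\<Sum>y\<in>X. k x y *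
     ((1 - \<alpha> + \<alpha> * (u y / u x)) * m * u y powr (m - 2) * laplacian X k (\<lambda>z. u z powr m) y
      - (m - \<alpha> + \<alpha> * (u y / u x) powr m) * u x powr (m - 2)
        * laplacian X k (\<lambda>z. u z powr m) x))"

definition G_op ::
  "'a set \<Rightarrow> ('a \<Rightarrow> 'a \<Rightarrow> real) \<Rightarrow> real \<Rightarrow> real \<Rightarrow> ('a \<Rightarrow> real) \<Rightarrow> 'a \<Rightarrow> real" where
  "G_op X k m \<alpha> v x = laplacian X k v x + \<alpha> * (Psi_tilde X k m v x / ((m - 1) * v x))"

definition CD_at ::
  "'a set \<Rightarrow> ('a \<Rightarrow> 'a \<Rightarrow> real) \<Rightarrow> real \<Rightarrow> real \<Rightarrow> real \<Rightarrow> 'a \<Rightarrow> bool" where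
  "CD_at X k m \<alpha> d x \<longleftrightarrow>
     (\<forall>u. (\<forall>y\<in>X. u y > 0) \<longrightarrow>
        (let G = G_op X k m \<alpha> (pressure m u) in
           - G x > 0 \<longrightarrow> (\<forall>y\<in>X. k x y > 0 \<longrightarrow> - G x \<ge> - G y) \<longrightarrow>
           D_op X k m \<alpha> u x \<ge> 1 / d * (- G x)^2))"

definition CD :: "'a set \<Rightarrow> ('a \<Rightarrow> 'a \<Rightarrow> real) \<Rightarrow> real \<Rightarrow> real \<Rightarrow> real \<Rightarrow> bool" where
  "CD X k m \<alpha> d \<longleftrightarrow> (\<forall>x\<in>X. CD_at X k m \<alpha> d x)"

text \<open>Nothing is required at time \<open>0\<close> beyond positivity (no differentiability, no continuity).\<close>

definition pme_solution ::
  "'a set \<Rightarrow> ('a \<Rightarrow> 'a \<Rightarrow> real) \<Rightarrow> real \<Rightarrow> (real \<Rightarrow> 'a \<Rightarrow> real) \<Rightarrow> bool" where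
  "pme_solution X k m u \<longleftrightarrow>
     (\<forall>t\<ge>0. \<forall>x\<in>X. u t x > 0) \<and>
     (\<forall>t>0. \<forall>x\<in>X.
        ((\<lambda>s. u s x) has_real_derivative laplacian X k (\<lambda>z. u t z powr m) x) (at t))"

end

theory Submission
  imports Defs
begin

text \<open>
  Let \<open>G\<close> be the quantity in the curvature-dimension condition. Along a solution, \<open>D_op\<close> is the time
  derivative of \<open>G\<close>, so at a spatial maximum of \<open>-G\<close> the condition reads \<open>(-G)' \<le> -(-G)\<^sup>2 / d\<close>,
  and the maximum principle yields the Aronson-Benilan estimate \<open>-G \<le> d / t\<close>. Since
  \<open>v' = (m - 1) v G + (1 - \<alpha>) \<Psi>(v)\<close>, the function \<open>V = t\<^sup>\<mu> v\<close> satisfies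
  \<open>V' \<ge> (1 - \<alpha>) t\<^sup>\<mu> \<Psi>(v) \<ge> 0\<close>.

  For an edge \<open>xy\<close> with \<open>v(x) \<ge> v(y)\<close>, \<open>\<Psi>(v)\<close> is at least \<open>k(x,y) (v(x) - v(y))\<^sup>2 / 2\<close> at \<open>x\<close> if \<open>m \<ge> 2\<close>,
  and at \<open>y\<close> if \<open>m \<le> 2\<close>. Differentiating an interpolation \<open>\<Phi> V(x) + (1 - \<Phi>) V(y)\<close> with \<open>\<Phi>\<close> quadratic in
  time and decreasing from \<open>1\<close> to \<open>0\<close>, and completing the square, one gets the inequality for a single
  edge without any integration. Summation over the edges of a path gives the general case.
\<close>

section \<open>The pointwise inequality for the pressure\<close>

text \<open>Weighted AM-GM for \<open>r\<close> and \<open>1\<close>, obtained from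
  \<open>1 + x \<le> exp x\<close> at \<open>(1 - q) ln r\<close> and \<open>- q ln r\<close>: with
  weights \<open>q\<close> and \<open>1 - q\<close> the linear terms cancel, and multiplication by
  \<open>r^q\<close> gives the claim.\<close>

lemma powr_le_Bernoulli:
  fixes r q :: real
  assumes "r > 0" "0 \<le> q" "q \<le> 1"
  shows "r powr q \<le> 1 + q * (r - 1)"
proof -
  have "1 = q * (1 + (1 - q) * ln r) + (1 - q) * (1 + - q * ln r)"
    by (simp add: algebra_simps)
  also have "\<dots> \<le> q * exp ((1 - q) * ln r) + (1 - q) * exp (- q * ln r)"
    using assms by (intro add_mono mult_left_mono exp_ge_add_one_self) auto
  finally have "exp (q * ln r) * 1
      \<le> exp (q * ln r) * (q * exp ((1 - q) * ln r) + (1 - q) * exp (- q * ln r))"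
    by (intro mult_left_mono) auto
  also have "\<dots> = q * exp (q * ln r + (1 - q) * ln r) + (1 - q) * exp (q * ln r + - q * ln r)"
    by (simp only: exp_add) (simp add: algebra_simps)
  also have "\<dots> = q * r + (1 - q)"
    using assms by (simp add: algebra_simps)
  finally show ?thesis
    using assms by (simp add: powr_def algebra_simps)
qed

text \<open>The concave case, applied to the base \<open>r^q\<close> with exponent
  \<open>1 / q\<close>.\<close>

lemma powr_ge_Bernoulli:
  fixes r q :: real
  assumes "r > 0" "q \<ge> 1"
  shows "1 + q * (r - 1) \<le> r powr q"
proof -
  have "(r powr q) powr (1 / q) \<le> 1 + 1 / q * (r powr q - 1)"
    using assms by (intro powr_le_Bernoulli) auto
  then have "r - 1 \<le> (r powr q - 1) / q"
    using assms by (simp add: powr_powr)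
  then show ?thesis
    using assms by (simp add: pos_le_divide_eq mult.commute)
qed

text \<open>The contribution of a single edge to \<open>Psi_tilde\<close>, with \<open>w\<close> the
  value at the vertex and \<open>z\<close> the value at its neighbour. It is isolated because all
  lower bounds hold edge by edge.\<close>

definition Psi_term :: "real \<Rightarrow> real \<Rightarrow> real \<Rightarrow> real" where
  "Psi_term m w z = (m - 1) / m * w^2
      + (m - 1)^2 / m * w powr ((m - 2) / (m - 1)) * z powr (m / (m - 1)) - (m - 1) * w * z"

lemma Psi_exponents: "m > 1 \<Longrightarrow> (m - 2) / (m - 1) + m / (m - 1) = (2 :: real)"
  by (simp add: add_divide_distrib[symmetric] nonzero_divide_eq_eq)

text \<open>The two exponents add up to \<open>2\<close>, so the expression is homogeneous of degree
  two and depends, up to \<open>w^2\<close>, only on the ratio \<open>z / w\<close>.\<close>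

lemma Psi_term_scale:
  assumes "m > 1" "w > 0" "z > 0"
  shows "Psi_term m w z = w^2 * Psi_term m 1 (z / w)"
proof -
  have "w powr ((m - 2) / (m - 1)) * w powr (m / (m - 1)) = w powr 2"
    using assms by (simp add: powr_add[symmetric] Psi_exponents)
  then have exchange: "w powr ((m - 2) / (m - 1)) * z powr (m / (m - 1)) = w^2 * (z / w) powr (m / (m - 1))"
    using assms by (simp add: powr_divide field_simps)
  have "w^2 * Psi_term m 1 (z / w) = (m - 1) / m * w^2
      + (m - 1)^2 / m * (w^2 * (z / w) powr (m / (m - 1))) - (m - 1) * (w^2 * (z / w))"
    by (simp add: Psi_term_def algebra_simps)
  also have "\<dots> = Psi_term m w z"
    unfolding exchange[symmetric] using assms by (simp add: Psi_term_def power2_eq_square)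
  finally show ?thesis ..
qed

text \<open>Replacing the convex power \<open>r^(m/(m-1))\<close> by its tangent at
  \<open>r = 1\<close> cancels the remaining terms exactly.\<close>

lemma Psi_term_nonneg:
  assumes "m > 1" "w > 0" "z > 0"
  shows "Psi_term m w z \<ge> 0"
proof -
  define r where "r = z / w"
  have r: "r > 0" using assms by (simp add: r_def)
  have "(m - 1)^2 / m * (1 + m / (m - 1) * (r - 1)) \<le> (m - 1)^2 / m * r powr (m / (m - 1))"
    using assms r by (intro mult_left_mono powr_ge_Bernoulli) (auto simp: field_simps)
  moreover have "(m - 1)^2 / m * (1 + m / (m - 1) * (r - 1)) = (m - 1) * r - (m - 1) / m"
    using assms by (simp add: field_simps power2_eq_square)
  ultimately have "Psi_term m 1 r \<ge> 0"
    by (simp add: Psi_term_def)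
  then show ?thesis
    using assms by (subst Psi_term_scale) (auto simp: r_def)
qed

text \<open>
  The restriction to one side of the diagonal is essential: the second derivative of
  \<open>Psi_term m 1 r\<close> in \<open>r\<close> is \<open>r powr (1 / (m - 1) - 1)\<close>, which is at least \<open>1\<close> on one side of
  \<open>r = 1\<close> only (unless \<open>m = 2\<close>).
\<close>

lemma Psi_term_quadratic_bound:
  assumes m: "m > 1" and wz: "w > 0" "z > 0"
    and side: "m \<ge> 2 \<and> z \<le> w \<or> m \<le> 2 \<and> w \<le> z"
  shows "Psi_term m w z \<ge> (w - z)^2 / 2"
proof -
  define r where "r = z / w"
  define q where "q = 1 / (m - 1)"
  define g where "g = (\<lambda>r. Psi_term m 1 r - (1 - r)^2 / 2)"
  have r: "r > 0" using wz by (simp add: r_def)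
  have mq: "m - 1 = 1 / q" "q > 0" using m by (auto simp: q_def)
  have exponent: "m / (m - 1) - 1 = q" using m by (simp add: q_def field_simps)
  \<comment> \<open>The derivative is the Bernoulli defect of \<open>s^q\<close> divided by
    \<open>q = 1 / (m - 1)\<close>. Its sign is fixed by \<open>q \<le> 1\<close> or
    \<open>q \<ge> 1\<close>, that is by the position of \<open>m\<close> relative to
    \<open>2\<close>, and \<open>g 1 = 0\<close> then gives \<open>g r \<ge> 0\<close> on the
    required side of \<open>1\<close>.\<close>
  have deriv: "(g has_real_derivative (s powr q - 1 - q * (s - 1)) / q) (at s)" if "s > 0" for s
  proof -
    define c where "c = (m - 1)^2 / m"
    define p where "p = m / (m - 1)"
    have g_eq: "g = (\<lambda>s. (m - 1) / m + c * s powr p - (m - 1) * s - (1 - s)^2 / 2)"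
      by (simp add: g_def Psi_term_def c_def p_def)
    have "(g has_real_derivative c * (p * s powr (p - 1)) - (m - 1) + (1 - s)) (at s)"
      unfolding g_eq by (rule derivative_eq_intros refl | (use that in simp; fail))+ (simp add: field_simps)
    then have "(g has_real_derivative
        (m - 1)^2 / m * (m / (m - 1) * s powr q) - (m - 1) + (1 - s)) (at s)"
      unfolding c_def p_def exponent .
    moreover have "(m - 1)^2 / m * (m / (m - 1) * s powr q) = (m - 1) * s powr q"
      using m by (simp add: field_simps power2_eq_square)
    moreover have "(m - 1) * s powr q - (m - 1) + (1 - s) = (s powr q - 1 - q * (s - 1)) / q"
      unfolding mq(1) using mq(2) by (simp add: field_simps)
    ultimately show ?thesis by simp
  qed
  have g1: "g 1 = 0"
    using m by (simp add: g_def Psi_term_def field_simps power2_eq_square)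
  have "g r \<ge> 0"
    using side
  proof
    assume *: "m \<ge> 2 \<and> z \<le> w"
    have "q \<le> 1" using * by (simp add: q_def)
    have "\<exists>y. (g has_real_derivative y) (at s) \<and> y \<le> 0" if s: "r \<le> s" "s \<le> 1" for s
    proof -
      have "s > 0" using s r by simp
      then have "(s powr q - 1 - q * (s - 1)) / q \<le> 0"
        using powr_le_Bernoulli[of s q] \<open>q \<le> 1\<close> mq(2) by (intro divide_nonpos_pos) auto
      with deriv[OF \<open>s > 0\<close>] show ?thesis by blast
    qed
    moreover have "r \<le> 1" using * wz by (simp add: r_def)
    ultimately have "g 1 \<le> g r"
      by (intro DERIV_nonpos_imp_nonincreasing[where f = g])
    then show ?thesis using g1 by simp
  next
    assume *: "m \<le> 2 \<and> w \<le> z"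
    have "q \<ge> 1" using * m by (simp add: q_def)
    have "\<exists>y. (g has_real_derivative y) (at s) \<and> y \<ge> 0" if s: "1 \<le> s" "s \<le> r" for s
    proof -
      have "s > 0" using s by simp
      then have "(s powr q - 1 - q * (s - 1)) / q \<ge> 0"
        using powr_ge_Bernoulli[of s q] \<open>q \<ge> 1\<close> mq(2) by (intro divide_nonneg_pos) auto
      with deriv[OF \<open>s > 0\<close>] show ?thesis by blast
    qed
    moreover have "r \<ge> 1" using * wz by (simp add: r_def)
    ultimately have "g 1 \<le> g r"
      by (intro DERIV_nonneg_imp_nondecreasing[where f = g])
    then show ?thesis using g1 by simp
  qed
  then have "w^2 * Psi_term m 1 r \<ge> w^2 * ((1 - r)^2 / 2)"
    by (intro mult_left_mono) (auto simp: g_def)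
  moreover have "w^2 * ((1 - r)^2 / 2) = (w - z)^2 / 2"
    using wz by (simp add: r_def field_simps power2_eq_square)
  ultimately show ?thesis
    using Psi_term_scale[OF m wz] by (simp add: r_def)
qed

section \<open>The edge terms and \<open>G\<close> in terms of \<open>u\<close>\<close>

lemma pressure_pos:
  assumes "m > 1" "u x > 0"
  shows "pressure m u x > 0"
  using assms by (simp add: pressure_def)

text \<open>The mixed power of the pressures collapses to \<open>u(x)^(m-2) u(y)^m\<close>, and
  \<open>m u^(m-2)\<close> is the derivative of the pressure in \<open>u\<close>. Summed over the
  edges, this is the discrete counterpart of
  \<open>m u^(m-2) Lu^m = (m-1) v Lv + |grad v|^2\<close>, with \<open>Psi_tilde\<close> in the role
  of the squared gradient.\<close>

lemma Psi_term_pressure: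
  assumes m: "m > 1" and u: "u x > 0" "u y > 0"
  shows "Psi_term m (pressure m u x) (pressure m u y) =
    m * u x powr (m - 2) * (u y powr m - u x powr m)
      - (m - 1) * pressure m u x * (pressure m u y - pressure m u x)"
proof -
  define c where "c = m / (m - 1)"
  have c: "c > 0" using m by (simp add: c_def)
  have "(c * u x powr (m - 1)) powr ((m - 2) / (m - 1))
        = c powr ((m - 2) / (m - 1)) * u x powr (m - 2)"
    using c u m by (simp add: powr_mult powr_powr)
  moreover have "(c * u y powr (m - 1)) powr (m / (m - 1)) = c powr (m / (m - 1)) * u y powr m"
    using c u m by (simp add: powr_mult powr_powr)
  moreover have "c powr ((m - 2) / (m - 1)) * c powr (m / (m - 1)) = c^2"
    using c m by (simp add: powr_add[symmetric] Psi_exponents)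
  ultimately have "(c * u x powr (m - 1)) powr ((m - 2) / (m - 1)) * (c * u y powr (m - 1)) powr (m / (m - 1))
      = c^2 * (u x powr (m - 2) * u y powr m)"
    by simp
  moreover have "(m - 1)^2 / m * c^2 = m"
    using m by (simp add: c_def power2_eq_square)
  ultimately have mixed: "(m - 1)^2 / m * pressure m u x powr ((m - 2) / (m - 1))
      * pressure m u y powr (m / (m - 1)) = m * (u x powr (m - 2) * u y powr m)"
    unfolding pressure_def c_def[symmetric] by (metis mult.assoc)
  have "u x powr (m - 2) * u x powr m = (u x powr (m - 1))^2"
    using u by (simp add: powr_add[symmetric] power2_eq_square)
  then have square: "m * (u x powr (m - 2) * u x powr m) = (m - 1)^2 / m * (pressure m u x)^2"
    using m by (simp add: pressure_def power2_eq_square)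
  have "(m - 1) / m * (pressure m u x)^2
      = (m - 1) * (pressure m u x)^2 - (m - 1)^2 / m * (pressure m u x)^2"
    using m by (simp add: field_simps power2_eq_square)
  then show ?thesis
    unfolding Psi_term_def mixed using square
    by (simp add: algebra_simps power2_eq_square)
qed

lemma Psi_tilde_altdef: "Psi_tilde X k m w x = (\<Sum>y\<in>X. k x y * Psi_term m (w x) (w y))"
  by (simp add: Psi_tilde_def Psi_term_def)

lemma Psi_tilde_pressure:
  assumes m: "m > 1" and u: "\<forall>y\<in>X. u y > 0" and x: "x \<in> X"
  shows "Psi_tilde X k m (pressure m u) x =
    m * u x powr (m - 2) * laplacian X k (\<lambda>z. u z powr m) x
      - (m - 1) * pressure m u x * laplacian X k (pressure m u) x"
  unfolding Psi_tilde_altdef laplacian_def sum_distrib_left sum_subtractf[symmetric]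
  using u x by (intro sum.cong refl) (simp add: Psi_term_pressure[OF m] algebra_simps)

text \<open>Division of the edge identity by \<open>(m - 1) v(x)\<close> leaves only powers of
  \<open>u\<close>; this is the form of \<open>G\<close> that is differentiated in time.\<close>

lemma G_op_pressure:
  assumes m: "m > 1" and u: "\<forall>y\<in>X. u y > 0" and x: "x \<in> X"
  shows "G_op X k m \<alpha> (pressure m u) x = (\<Sum>y\<in>X. k x y *
    ((1 - \<alpha>) * m / (m - 1) * u y powr (m - 1) - (m - \<alpha>) / (m - 1) * u x powr (m - 1)
      + \<alpha> * (u y powr m / u x)))"
proof -
  have term_eq: "(pressure m u y - pressure m u x)
      + \<alpha> * (Psi_term m (pressure m u x) (pressure m u y) / ((m - 1) * pressure m u x))
    = (1 - \<alpha>) * m / (m - 1) * u y powr (m - 1) - (m - \<alpha>) / (m - 1) * u x powr (m - 1)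
      + \<alpha> * (u y powr m / u x)" (is "?lhs = _") if "y \<in> X" for y
  proof -
    have pos: "u x > 0" "u y > 0" "pressure m u x > 0"
      using u x that m by (auto simp: pressure_pos)
    have "u x powr (m - 2) = u x powr (m - 1) / u x" "u x powr m = u x powr (m - 1) * u x"
      using pos by (simp_all add: powr_diff power2_eq_square)
    then have "m * u x powr (m - 2) * (u y powr m - u x powr m) / ((m - 1) * pressure m u x)
        = u y powr m / u x - u x powr (m - 1)"
      using m pos by (simp add: pressure_def divide_simps)
    then have ratio: "Psi_term m (pressure m u x) (pressure m u y) / ((m - 1) * pressure m u x)
        = u y powr m / u x - u x powr (m - 1) - (pressure m u y - pressure m u x)"
      using m pos by (simp add: Psi_term_pressure diff_divide_distrib)
    have "?lhs = (1 - \<alpha>) * pressure m u y - pressure m u x + \<alpha> * (u y powr m / u x)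
        + \<alpha> * (pressure m u x - u x powr (m - 1))"
      unfolding ratio by (simp add: algebra_simps)
    moreover have "\<alpha> * (pressure m u x - u x powr (m - 1)) - pressure m u x
        = - ((m - \<alpha>) / (m - 1) * u x powr (m - 1))"
      using m by (simp add: pressure_def divide_simps) (simp add: algebra_simps)
    ultimately show ?thesis
      by (simp add: pressure_def)
  qed
  have "G_op X k m \<alpha> (pressure m u) x = (\<Sum>y\<in>X. k x y * ((pressure m u y - pressure m u x)
      + \<alpha> * (Psi_term m (pressure m u x) (pressure m u y) / ((m - 1) * pressure m u x))))"
    unfolding G_op_def laplacian_def Psi_tilde_altdef sum_divide_distrib sum_distrib_left
      sum.distrib[symmetric]
    by (intro sum.cong refl) (simp add: distrib_left)
  then show ?thesis
    using term_eq by (simp cong: sum.cong)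
qed

section \<open>Comparison principles in time\<close>

text \<open>Maximum principle: where \<open>s f\<close> is maximal over times and points and exceeds
  \<open>d\<close>, the decay \<open>f' \<le> - f^2 / d\<close> makes its time derivative negative,
  so it was larger just before.\<close>

lemma finite_family_decay:
  fixes f f' :: "real \<Rightarrow> 'b \<Rightarrow> real"
  assumes fin: "finite X" and d: "d > 0"
    and deriv: "\<And>t x. t > 0 \<Longrightarrow> x \<in> X \<Longrightarrow> ((\<lambda>s. f s x) has_real_derivative f' t x) (at t)"
    and decay: "\<And>t x. t > 0 \<Longrightarrow> x \<in> X \<Longrightarrow> f t x > 0 \<Longrightarrow> \<forall>y\<in>X. f t y \<le> f t x \<Longrightarrow>
      f' t x \<le> - ((f t x)^2 / d)"
    and t: "t > 0" and x: "x \<in> X"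
  shows "f t x \<le> d / t"
proof -
  have shifted: "(t - e) * f t x \<le> d" if e: "0 < e" "e < t" for e
  proof -
    \<comment> \<open>The shift makes \<open>H\<close> vanish at time \<open>e\<close> and keeps the
      interval away from time \<open>0\<close>, where no continuity is known. A maximum above
      \<open>d > 0\<close> is therefore attained after \<open>e\<close> and can be compared with
      earlier times.\<close>
    define H where "H = (\<lambda>s y. (s - e) * f s y)"
    have H_deriv: "((\<lambda>s. H s y) has_real_derivative f s y + (s - e) * f' s y) (at s)"
      if "s > 0" "y \<in> X" for s y
      unfolding H_def by (auto intro!: derivative_eq_intros deriv that)
    have "\<exists>s. e \<le> s \<and> s \<le> t \<and> (\<forall>r. e \<le> r \<and> r \<le> t \<longrightarrow> H r y \<le> H s y)" if y: "y \<in> X" for y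
    proof -
      have "\<forall>r. e \<le> r \<and> r \<le> t \<longrightarrow> isCont (\<lambda>s. H s y) r"
        using DERIV_isCont[OF H_deriv[OF _ y]] e by auto
      from isCont_eq_Ub[OF _ this] e show ?thesis by (metis less_imp_le)
    qed
    then obtain \<sigma> where \<sigma>: "\<And>y. y \<in> X \<Longrightarrow> e \<le> \<sigma> y \<and> \<sigma> y \<le> t"
      "\<And>y r. y \<in> X \<Longrightarrow> e \<le> r \<Longrightarrow> r \<le> t \<Longrightarrow> H r y \<le> H (\<sigma> y) y"
      by metis
    have "Max ((\<lambda>y. H (\<sigma> y) y) ` X) \<in> (\<lambda>y. H (\<sigma> y) y) ` X"
      using fin x by (intro Max_in) auto
    then obtain z where z: "z \<in> X" "H (\<sigma> z) z = Max ((\<lambda>y. H (\<sigma> y) y) ` X)" by force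
    have max: "H r y \<le> H (\<sigma> z) z" if "y \<in> X" "e \<le> r" "r \<le> t" for y r
    proof -
      have "H (\<sigma> y) y \<le> H (\<sigma> z) z" unfolding z(2) using fin that by (intro Max_ge) auto
      then show ?thesis using \<sigma>(2)[OF that] by simp
    qed
    have "H (\<sigma> z) z \<le> d"
    proof (rule ccontr)
      assume big: "\<not> H (\<sigma> z) z \<le> d"
      define s where "s = \<sigma> z"
      have s: "e \<le> s" "s \<le> t" using \<sigma>(1)[OF z(1)] by (auto simp: s_def)
      have H_pos: "(s - e) * f s z > d" using big by (simp add: H_def s_def)
      with d s have "s > e" by (cases "s = e") auto
      with H_pos d have f_pos: "f s z > 0"
        by (metis diff_gt_0_iff_gt less_trans zero_less_mult_pos)
      have "\<forall>y\<in>X. f s y \<le> f s z"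
      proof
        fix y assume "y \<in> X"
        from max[OF this s] have "(s - e) * f s y \<le> (s - e) * f s z" by (simp add: H_def s_def)
        then show "f s y \<le> f s z" using \<open>s > e\<close> by simp
      qed
      with decay[of s z] f_pos z(1) s e have "f' s z \<le> - ((f s z)^2 / d)" by simp
      then have "(s - e) * f' s z \<le> (s - e) * (- ((f s z)^2 / d))"
        using \<open>s > e\<close> by (intro mult_left_mono) auto
      \<comment> \<open>The factor \<open>(s - e) f / d\<close> exceeds \<open>1\<close>, which is
        what lets the quadratic decay beat the term \<open>f\<close> of the product rule.\<close>
      also have "\<dots> = - f s z * (((s - e) * f s z) / d)"
        by (simp add: power2_eq_square)
      also have "\<dots> < - f s z"
      proof -
        have "1 < (s - e) * f s z / d" using H_pos d by simp
        from mult_strict_left_mono[OF this f_pos] show ?thesis by simp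
      qed
      finally have "f s z + (s - e) * f' s z < 0" by simp
      from DERIV_neg_dec_left[OF H_deriv[of s z] this] s e z(1)
      obtain \<delta> where \<delta>: "\<delta> > 0" "\<And>h. h > 0 \<Longrightarrow> h < \<delta> \<Longrightarrow> H s z < H (s - h) z" by auto
      define h where "h = min (\<delta> / 2) ((s - e) / 2)"
      have h: "h > 0" "h < \<delta>" "e \<le> s - h" "s - h \<le> t"
        using \<delta>(1) \<open>s > e\<close> s by (auto simp: h_def min_def field_simps)
      from \<delta>(2)[OF h(1,2)] max[OF z(1) h(3,4)] show False by (simp add: s_def)
    qed
    with max[OF x, of t] e show ?thesis by (simp add: H_def)
  qed
  show ?thesis
  proof (rule ccontr)
    assume "\<not> f t x \<le> d / t"
    then have gap: "t * f t x > d" using t by (simp add: field_simps)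
    then have f: "f t x > 0" using d t by (metis less_trans zero_less_mult_pos)
    \<comment> \<open>This choice turns \<open>(t - e) f t x\<close> into the midpoint of
      \<open>t f t x\<close> and \<open>d\<close>, which is still above \<open>d\<close>.\<close>
    define e where "e = (t * f t x - d) / (2 * f t x)"
    have "0 < e" using gap f by (simp add: e_def)
    moreover have "e < t"
    proof -
      have "t * f t x - d < t * (2 * f t x)" using d mult_pos_pos[OF t f] by linarith
      then show ?thesis using f by (simp add: e_def pos_divide_less_eq)
    qed
    ultimately have "(t - e) * f t x \<le> d" by (rule shifted)
    moreover have "(t - e) * f t x = (t * f t x + d) / 2"
      using f by (simp add: e_def field_simps)
    ultimately show False using gap by simp
  qed
qed

text \<open>The function \<open>\<Phi> a + (1 - \<Phi>) b + R\<close> starts at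
  \<open>a s1 + R s1\<close>, ends at \<open>b s2 + R s2\<close> and is nondecreasing. Where
  \<open>a < b\<close>, the term \<open>\<Phi>' (a - b)\<close> is itself nonnegative, so the bound
  is asked for only where \<open>b \<le> a\<close>.\<close>

lemma interpolated_comparison:
  fixes a b \<Phi> R :: "real \<Rightarrow> real"
  assumes "s1 \<le> s2" "\<Phi> s1 = 1" "\<Phi> s2 = 0"
    and deriv: "\<And>t. s1 \<le> t \<Longrightarrow> t \<le> s2 \<Longrightarrow> (a has_real_derivative a' t) (at t)"
      "\<And>t. s1 \<le> t \<Longrightarrow> t \<le> s2 \<Longrightarrow> (b has_real_derivative b' t) (at t)"
      "\<And>t. s1 \<le> t \<Longrightarrow> t \<le> s2 \<Longrightarrow> (\<Phi> has_real_derivative \<Phi>' t) (at t)"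
      "\<And>t. s1 \<le> t \<Longrightarrow> t \<le> s2 \<Longrightarrow> (R has_real_derivative R' t) (at t)"
    and sign: "\<And>t. s1 \<le> t \<Longrightarrow> t \<le> s2 \<Longrightarrow> 0 \<le> a' t \<and> 0 \<le> b' t \<and> 0 \<le> R' t \<and>
      \<Phi>' t \<le> 0 \<and> 0 \<le> \<Phi> t \<and> \<Phi> t \<le> 1"
    and bound: "\<And>t. s1 \<le> t \<Longrightarrow> t \<le> s2 \<Longrightarrow> b t \<le> a t \<Longrightarrow>
      - \<Phi>' t * (a t - b t) \<le> \<Phi> t * a' t + (1 - \<Phi> t) * b' t + R' t"
  shows "a s1 \<le> b s2 + (R s2 - R s1)"
proof -
  define F where "F = (\<lambda>t. \<Phi> t * a t + (1 - \<Phi> t) * b t + R t)"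
  have "F s1 \<le> F s2"
  proof (rule DERIV_nonneg_imp_nondecreasing[where f = F and a = s1 and b = s2])
    fix t assume t: "s1 \<le> t" "t \<le> s2"
    have "(F has_real_derivative
        \<Phi>' t * (a t - b t) + \<Phi> t * a' t + (1 - \<Phi> t) * b' t + R' t) (at t)"
      unfolding F_def
      by (rule derivative_eq_intros deriv refl t)+ (simp add: algebra_simps)
    moreover have "\<Phi>' t * (a t - b t) + \<Phi> t * a' t + (1 - \<Phi> t) * b' t + R' t \<ge> 0"
    proof (cases "b t \<le> a t")
      case True
      then show ?thesis using bound[OF t] by simp
    next
      case False
      then have "\<Phi>' t * (a t - b t) \<ge> 0" using sign[OF t] by (intro mult_nonpos_nonpos) auto
      moreover have "\<Phi> t * a' t \<ge> 0" "(1 - \<Phi> t) * b' t \<ge> 0" using sign[OF t] by simp_all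
      ultimately show ?thesis using sign[OF t] by simp
    qed
    ultimately show "\<exists>y. (F has_real_derivative y) (at t) \<and> 0 \<le> y" by blast
  qed (fact assms)
  then show ?thesis using assms(2,3) by (simp add: F_def)
qed

text \<open>Completion of the square in \<open>\<theta> D\<close>. The remainder contains neither
  \<open>\<theta>\<close> nor \<open>D\<close>; for \<open>p = c / t^\<mu>\<close> it is a multiple
  of \<open>t^\<mu>\<close>.\<close>

lemma weighted_square_bound:
  fixes p \<theta> D T :: real
  assumes "p > 0" "T > 0"
  shows "2 * \<theta> / T * D \<le> \<theta>^2 * (p * D^2) + 1 / (p * T^2)"
proof -
  have "0 \<le> p * (\<theta> * D - 1 / (p * T))^2" using assms by simp
  also have "\<dots> = \<theta>^2 * (p * D^2) - 2 * \<theta> / T * D + 1 / (p * T^2)"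
    using assms by (simp add: power2_eq_square field_simps)
  finally show ?thesis by simp
qed

text \<open>
  The weight \<open>\<theta>\<^sup>2\<close> with \<open>\<theta>\<close> affine multiplies the derivative that is known to grow, so that it
  equals \<open>\<Phi>\<close> in the first case and \<open>1 - \<Phi>\<close> in the second one. This choice makes
  \<open>(\<Phi>')\<^sup>2 / \<theta>\<^sup>2\<close> constant, and it gives the constant of the theorem.
\<close>

lemma monotone_pair_comparison:
  fixes a b :: "real \<Rightarrow> real"
  assumes s: "0 < s1" "s1 < s2" and c: "c > 0" and \<mu>: "\<mu> > 0"
    and deriv: "\<And>t. t > 0 \<Longrightarrow> (a has_real_derivative a' t) (at t)"
      "\<And>t. t > 0 \<Longrightarrow> (b has_real_derivative b' t) (at t)"
    and nonneg: "\<And>t. t > 0 \<Longrightarrow> a' t \<ge> 0" "\<And>t. t > 0 \<Longrightarrow> b' t \<ge> 0"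
    and growth: "(\<forall>t>0. b t \<le> a t \<longrightarrow> a' t \<ge> c / t powr \<mu> * (a t - b t)^2) \<or>
      (\<forall>t>0. b t \<le> a t \<longrightarrow> b' t \<ge> c / t powr \<mu> * (a t - b t)^2)"
  shows "a s1 \<le> b s2 + (s2 powr (\<mu> + 1) - s1 powr (\<mu> + 1)) / ((\<mu> + 1) * c * (s2 - s1)^2)"
proof -
  define T where "T = s2 - s1"
  \<comment> \<open>An antiderivative of \<open>R'\<close>, the remainder left by completing the
    square with \<open>p = c / t^\<mu>\<close>.\<close>
  define R where "R = (\<lambda>t. t powr (\<mu> + 1) / ((\<mu> + 1) * c * T^2))"
  define R' where "R' = (\<lambda>t. t powr \<mu> / (c * T^2))"
  have T: "T > 0" using s by (simp add: T_def)
  have R_deriv: "(R has_real_derivative R' t) (at t)" if "t > 0" for t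
  proof -
    define \<kappa> where "\<kappa> = 1 / ((\<mu> + 1) * c * T^2)"
    have R_eq: "R = (\<lambda>t. \<kappa> * t powr (\<mu> + 1))"
      by (simp add: R_def \<kappa>_def)
    have "(R has_real_derivative \<kappa> * ((\<mu> + 1) * t powr \<mu>)) (at t)"
      unfolding R_eq by (rule derivative_eq_intros refl | (use that in simp; fail))+
    then show ?thesis using \<mu> by (simp add: R'_def \<kappa>_def)
  qed
  have young: "2 * \<theta> / T * D \<le> \<theta>^2 * (c / t powr \<mu> * D^2) + R' t" if "t > 0" for \<theta> D t
    using weighted_square_bound[of "c / t powr \<mu>" T \<theta> D] that c T by (simp add: R'_def)
  have R'_nonneg: "R' t \<ge> 0" for t using c by (simp add: R'_def)
  \<comment> \<open>Both cases differ only in \<open>\<theta>\<close> and \<open>\<Phi>\<close>.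
    Since \<open>\<Phi>' = - 2 \<theta> / T\<close>, the loss \<open>- \<Phi>' (a - b)\<close> is
    covered by \<open>young\<close>, whose square term is absorbed by the last assumption.\<close>
  have compare: "a s1 \<le> b s2 + (R s2 - R s1)"
    if \<Phi>: "\<Phi> s1 = 1" "\<Phi> s2 = 0" "\<And>t. (\<Phi> has_real_derivative - (2 * \<theta> t / T)) (at t)"
      "\<And>t. s1 \<le> t \<Longrightarrow> t \<le> s2 \<Longrightarrow> 0 \<le> \<theta> t \<and> 0 \<le> \<Phi> t \<and> \<Phi> t \<le> 1"
      "\<And>t. t > 0 \<Longrightarrow> s1 \<le> t \<Longrightarrow> t \<le> s2 \<Longrightarrow> b t \<le> a t \<Longrightarrow>
        (\<theta> t)^2 * (c / t powr \<mu> * (a t - b t)^2) \<le> \<Phi> t * a' t + (1 - \<Phi> t) * b' t"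
    for \<Phi> \<theta>
  proof (rule interpolated_comparison[where \<Phi> = \<Phi> and \<Phi>' = "\<lambda>t. - (2 * \<theta> t / T)" and R' = R'
        and a = a and b = b and a' = a' and b' = b' and ?s1.0 = s1 and ?s2.0 = s2])
    fix t assume t: "s1 \<le> t" "t \<le> s2"
    then have t0: "t > 0" using s by simp
    show "(a has_real_derivative a' t) (at t)" "(b has_real_derivative b' t) (at t)"
      "(R has_real_derivative R' t) (at t)"
      using deriv R_deriv t0 by auto
    show "0 \<le> a' t \<and> 0 \<le> b' t \<and> 0 \<le> R' t \<and> - (2 * \<theta> t / T) \<le> 0 \<and> 0 \<le> \<Phi> t \<and> \<Phi> t \<le> 1"
      using nonneg[OF t0] R'_nonneg[of t] \<Phi>(4)[OF t] T by simp
    show "- (- (2 * \<theta> t / T)) * (a t - b t) \<le> \<Phi> t * a' t + (1 - \<Phi> t) * b' t + R' t"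
      if "b t \<le> a t"
      using young[OF t0, of "\<theta> t" "a t - b t"] \<Phi>(5)[OF t0 t that] by simp
  qed (use s \<Phi> in auto)
  have unit: "0 \<le> (s2 - t) / T \<and> (s2 - t) / T \<le> 1 \<and> 0 \<le> (t - s1) / T \<and> (t - s1) / T \<le> 1"
    if "s1 \<le> t" "t \<le> s2" for t
    using that T by (simp add: T_def)
  have "a s1 \<le> b s2 + (R s2 - R s1)"
    using growth
  proof
    assume growth_a: "\<forall>t>0. b t \<le> a t \<longrightarrow> a' t \<ge> c / t powr \<mu> * (a t - b t)^2"
    show ?thesis
    proof (rule compare[of "\<lambda>t. ((s2 - t) / T)^2" "\<lambda>t. (s2 - t) / T"])
      show "((\<lambda>t. ((s2 - t) / T)^2) has_real_derivative - (2 * ((s2 - t) / T) / T)) (at t)" for t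
        using T by (auto intro!: derivative_eq_intros simp: field_simps power2_eq_square power4_eq_xxxx)
      fix t assume t: "s1 \<le> t" "t \<le> s2"
      then show "0 \<le> (s2 - t) / T \<and> 0 \<le> ((s2 - t) / T)^2 \<and> ((s2 - t) / T)^2 \<le> 1"
        using unit[of t] by (simp add: power_le_one)
      then have "(1 - ((s2 - t) / T)^2) * b' t \<ge> 0" if "t > 0"
        using nonneg(2)[OF that] by (intro mult_nonneg_nonneg) auto
      moreover have "((s2 - t) / T)^2 * (c / t powr \<mu> * (a t - b t)^2) \<le> ((s2 - t) / T)^2 * a' t"
        if "t > 0" "b t \<le> a t"
        using growth_a that by (intro mult_left_mono) auto
      ultimately show "((s2 - t) / T)^2 * (c / t powr \<mu> * (a t - b t)^2)
          \<le> ((s2 - t) / T)^2 * a' t + (1 - ((s2 - t) / T)^2) * b' t" if "t > 0" "b t \<le> a t"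
        using that by (smt (verit))
    qed (use T in \<open>auto simp: T_def\<close>)
  next
    assume growth_b: "\<forall>t>0. b t \<le> a t \<longrightarrow> b' t \<ge> c / t powr \<mu> * (a t - b t)^2"
    show ?thesis
    proof (rule compare[of "\<lambda>t. 1 - ((t - s1) / T)^2" "\<lambda>t. (t - s1) / T"])
      show "((\<lambda>t. 1 - ((t - s1) / T)^2) has_real_derivative - (2 * ((t - s1) / T) / T)) (at t)" for t
        using T by (auto intro!: derivative_eq_intros simp: field_simps power2_eq_square power4_eq_xxxx)
      fix t assume t: "s1 \<le> t" "t \<le> s2"
      then show "0 \<le> (t - s1) / T \<and> 0 \<le> 1 - ((t - s1) / T)^2 \<and> 1 - ((t - s1) / T)^2 \<le> 1"
        using unit[of t] by (simp add: power_le_one)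
      then have "(1 - ((t - s1) / T)^2) * a' t \<ge> 0" if "t > 0"
        using nonneg(1)[OF that] by (intro mult_nonneg_nonneg) auto
      moreover have "((t - s1) / T)^2 * (c / t powr \<mu> * (a t - b t)^2) \<le> ((t - s1) / T)^2 * b' t"
        if "t > 0" "b t \<le> a t"
        using growth_b that by (intro mult_left_mono) auto
      ultimately show "((t - s1) / T)^2 * (c / t powr \<mu> * (a t - b t)^2)
          \<le> (1 - ((t - s1) / T)^2) * a' t + (1 - (1 - ((t - s1) / T)^2)) * b' t"
        if "t > 0" "b t \<le> a t"
        using that by (smt (verit))
    qed (use T in \<open>auto simp: T_def\<close>)
  qed
  also have "R s2 - R s1 = (s2 powr (\<mu> + 1) - s1 powr (\<mu> + 1)) / ((\<mu> + 1) * c * (s2 - s1)^2)"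
    by (simp add: R_def T_def diff_divide_distrib)
  finally show ?thesis .
qed

section \<open>Solutions under the curvature-dimension condition\<close>

locale CD_flow =
  fixes X :: "'a set" and k :: "'a \<Rightarrow> 'a \<Rightarrow> real" and m \<alpha> d :: real
    and u :: "real \<Rightarrow> 'a \<Rightarrow> real"
  assumes m: "m > 1"
    and fin: "finite X"
    and k_nonneg: "\<And>x y. x \<in> X \<Longrightarrow> y \<in> X \<Longrightarrow> k x y \<ge> 0"
    and k_sym: "\<And>x y. x \<in> X \<Longrightarrow> y \<in> X \<Longrightarrow> k x y = k y x"
    and d: "d > 0" and \<alpha>: "\<alpha> < 1"
    and CD: "CD X k m \<alpha> d"
    and sol: "pme_solution X k m u"
begin

abbreviation "\<mu> \<equiv> (m - 1) * d"
abbreviation "G t x \<equiv> G_op X k m \<alpha> (pressure m (u t)) x"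
abbreviation "\<Psi> t x \<equiv> Psi_tilde X k m (pressure m (u t)) x"
abbreviation "V t x \<equiv> t powr \<mu> * pressure m (u t) x"

section \<open>Time derivatives and the Aronson-Benilan estimate\<close>

lemma u_pos: "t \<ge> 0 \<Longrightarrow> x \<in> X \<Longrightarrow> u t x > 0"
  using sol by (simp add: pme_solution_def)

lemma u_powr_deriv:
  assumes "t > 0" "x \<in> X"
  shows "((\<lambda>s. u s x powr r) has_real_derivative
    r * u t x powr (r - 1) * laplacian X k (\<lambda>z. u t z powr m) x) (at t)"
proof -
  have "((\<lambda>s. u s x) has_real_derivative laplacian X k (\<lambda>z. u t z powr m) x) (at t)"
    using sol assms by (simp add: pme_solution_def)
  from DERIV_chain2[OF has_real_derivative_powr this] u_pos[of t x] assms show ?thesis by simp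
qed

text \<open>Termwise differentiation of the power form of \<open>G\<close>, with
  \<open>u' = Lu^m\<close> inserted; this identifies \<open>D_op\<close> as the time derivative of
  \<open>G\<close> along the flow.\<close>

lemma G_deriv:
  assumes t: "t > 0" and x: "x \<in> X"
  shows "((\<lambda>s. G s x) has_real_derivative D_op X k m \<alpha> (u t) x) (at t)"
proof -
  define L where "L = (\<lambda>y. laplacian X k (\<lambda>z. u t z powr m) y)"
  define f where "f = (\<lambda>s y. (1 - \<alpha>) * m / (m - 1) * u s y powr (m - 1)
      - (m - \<alpha>) / (m - 1) * u s x powr (m - 1) + \<alpha> * (u s y powr m / u s x))"
  have f_deriv: "((\<lambda>s. f s y) has_real_derivative
      (1 - \<alpha> + \<alpha> * (u t y / u t x)) * m * u t y powr (m - 2) * L y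
        - (m - \<alpha> + \<alpha> * (u t y / u t x) powr m) * u t x powr (m - 2) * L x) (at t)"
    if y: "y \<in> X" for y
  proof -
    note pos = u_pos[OF less_imp_le[OF t] x] u_pos[OF less_imp_le[OF t] y]
    have u_deriv: "((\<lambda>s. u s x) has_real_derivative L x) (at t)"
      using sol t x by (simp add: pme_solution_def L_def)
    have powr_deriv: "((\<lambda>s. u s z powr r) has_real_derivative r * u t z powr (r - 1) * L z) (at t)"
      if "z \<in> X" for z r
      unfolding L_def by (rule u_powr_deriv[OF t that])
    have raw: "((\<lambda>s. f s y) has_real_derivative
        (1 - \<alpha>) * m / (m - 1) * ((m - 1) * u t y powr (m - 1 - 1) * L y)
        - (m - \<alpha>) / (m - 1) * ((m - 1) * u t x powr (m - 1 - 1) * L x)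
        + \<alpha> * ((m * u t y powr (m - 1) * L y * u t x - u t y powr m * L x) / (u t x * u t x)))
        (at t)"
      unfolding f_def using pos(1)
      by (intro DERIV_add DERIV_diff DERIV_cmult DERIV_divide powr_deriv u_deriv x y) auto
    have at_y: "(1 - \<alpha>) * m / (m - 1) * ((m - 1) * u t y powr (m - 1 - 1) * L y)
        = (1 - \<alpha>) * m * u t y powr (m - 2) * L y"
      using m by simp
    have at_x: "(m - \<alpha>) / (m - 1) * ((m - 1) * u t x powr (m - 1 - 1) * L x)
        = (m - \<alpha>) * u t x powr (m - 2) * L x"
      using m by simp
    have quotient: "(m * u t y powr (m - 1) * L y * u t x - u t y powr m * L x) / (u t x * u t x)
        = (u t y / u t x) * m * u t y powr (m - 2) * L y
          - (u t y / u t x) powr m * u t x powr (m - 2) * L x"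
    proof -
      have "u t y powr (m - 1) = u t y * u t y powr (m - 2)"
        using pos powr_add[of "u t y" 1 "m - 2"] by simp
      moreover have "(u t y / u t x) powr m * u t x powr (m - 2) = u t y powr m / (u t x * u t x)"
        using pos by (simp add: powr_divide powr_diff power2_eq_square)
      ultimately show ?thesis using pos by (simp add: diff_divide_distrib)
    qed
    show ?thesis
      by (rule DERIV_cong[OF raw[unfolded at_y at_x quotient]]) (simp add: algebra_simps)
  qed
  have "((\<lambda>s. \<Sum>y\<in>X. k x y * f s y) has_real_derivative D_op X k m \<alpha> (u t) x) (at t)"
    unfolding D_op_def by (intro DERIV_sum DERIV_cmult f_deriv[unfolded L_def])
  \<comment> \<open>The power form requires positivity of \<open>u\<close>, so the derivative is
    transferred on the open half-line.\<close>
  moreover have "(\<Sum>y\<in>X. k x y * f s y) = G s x" if "s \<in> {0<..}" for s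
    using that u_pos[of s] by (subst G_op_pressure[OF m _ x]) (auto simp: f_def)
  ultimately show ?thesis
    using t by (elim has_field_derivative_transform_within_open[where S = "{0<..}"]) auto
qed

text \<open>A maximum of \<open>-G\<close> over \<open>X\<close> is in particular one over the
  neighbours of the point, so \<open>CD_at\<close> applies there and supplies the decay hypothesis
  of the maximum principle.\<close>

lemma Aronson_Benilan:
  assumes "t > 0" "x \<in> X"
  shows "- G t x \<le> d / t"
proof (rule finite_family_decay[OF fin d _ _ assms])
  show "((\<lambda>s. - G s x) has_real_derivative - D_op X k m \<alpha> (u t) x) (at t)"
    if "t > 0" "x \<in> X" for t x
    by (intro DERIV_minus G_deriv that)
  show "- D_op X k m \<alpha> (u t) x \<le> - ((- G t x)^2 / d)"
    if "t > 0" "x \<in> X" "- G t x > 0" "\<forall>y\<in>X. - G t y \<le> - G t x" for t x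
  proof -
    have "CD_at X k m \<alpha> d x" using CD that by (simp add: CD_def)
    then have "1 / d * (- G t x)^2 \<le> D_op X k m \<alpha> (u t) x"
      using that u_pos[of t] unfolding CD_at_def Let_def by (metis less_imp_le)
    then show ?thesis by simp
  qed
qed

text \<open>The chain rule gives \<open>v' = (m-1) v Lv + \<Psi>\<close>. The second summand of
  \<open>G\<close> absorbs the share \<open>\<alpha> \<Psi>\<close>, which leaves the factor
  \<open>1 - \<alpha>\<close>.\<close>

lemma pressure_deriv:
  assumes t: "t > 0" and x: "x \<in> X"
  shows "((\<lambda>s. pressure m (u s) x) has_real_derivative
    (m - 1) * pressure m (u t) x * G t x + (1 - \<alpha>) * \<Psi> t x) (at t)"
proof -
  define v where "v = pressure m (u t) x"
  have v: "v > 0" using u_pos[of t x] t x m by (simp add: v_def pressure_pos)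
  have "((\<lambda>s. pressure m (u s) x) has_real_derivative
      m / (m - 1) * ((m - 1) * u t x powr (m - 1 - 1) * laplacian X k (\<lambda>z. u t z powr m) x)) (at t)"
    unfolding pressure_def by (intro DERIV_cmult u_powr_deriv t x)
  moreover have "m / (m - 1) * ((m - 1) * u t x powr (m - 1 - 1) * laplacian X k (\<lambda>z. u t z powr m) x)
      = m * u t x powr (m - 2) * laplacian X k (\<lambda>z. u t z powr m) x"
    using m by simp
  moreover have "\<dots> = (m - 1) * v * laplacian X k (pressure m (u t)) x + \<Psi> t x"
    using u_pos[of t] t by (subst Psi_tilde_pressure[OF m _ x]) (auto simp: v_def)
  moreover have "\<dots> = (m - 1) * v * G t x + (1 - \<alpha>) * \<Psi> t x"
  proof -
    have "(m - 1) * v * G t x = (m - 1) * v * laplacian X k (pressure m (u t)) x + \<alpha> * \<Psi> t x"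
      using m v by (simp add: G_op_def v_def[symmetric] distrib_left)
    then show ?thesis by (simp add: algebra_simps)
  qed
  ultimately show ?thesis unfolding v_def by simp
qed

section \<open>Monotonicity and quadratic growth of the weighted pressure\<close>

definition V' :: "real \<Rightarrow> 'a \<Rightarrow> real" where
  "V' t x = \<mu> * t powr (\<mu> - 1) * pressure m (u t) x
    + t powr \<mu> * ((m - 1) * pressure m (u t) x * G t x + (1 - \<alpha>) * \<Psi> t x)"

lemma V_deriv:
  assumes "t > 0" "x \<in> X"
  shows "((\<lambda>s. V s x) has_real_derivative V' t x) (at t)"
  by (rule DERIV_cong[OF DERIV_mult[OF has_real_derivative_powr[OF assms(1)] pressure_deriv[OF assms]]])
    (simp add: V'_def)

text \<open>The exponent \<open>\<mu> = (m - 1) d\<close> is the one for which the Aronson-Benilan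
  estimate reads \<open>\<mu> / t + (m - 1) G \<ge> 0\<close>; this factor multiplies the part of
  \<open>V'\<close> that is dropped.\<close>

lemma V'_ge_Psi:
  assumes t: "t > 0" and x: "x \<in> X"
  shows "V' t x \<ge> (1 - \<alpha>) * t powr \<mu> * \<Psi> t x"
proof -
  define v where "v = pressure m (u t) x"
  have v: "v > 0" using u_pos[of t x] t x m by (simp add: v_def pressure_pos)
  have "\<mu> / t + (m - 1) * G t x = (m - 1) * (d / t + G t x)" by (simp add: algebra_simps)
  moreover have "\<dots> \<ge> 0" using Aronson_Benilan[OF t x] m by simp
  ultimately have "t powr \<mu> * v * (\<mu> / t + (m - 1) * G t x) \<ge> 0" using v by simp
  moreover have "V' t x = t powr \<mu> * v * (\<mu> / t + (m - 1) * G t x) + (1 - \<alpha>) * t powr \<mu> * \<Psi> t x"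
  proof -
    define P where "P = t powr \<mu>"
    have shift: "t powr (\<mu> - 1) = P / t"
      using t by (simp add: P_def powr_diff)
    show ?thesis
      unfolding V'_def v_def[symmetric] shift P_def[symmetric] using t by (simp add: field_simps)
  qed
  ultimately show ?thesis by simp
qed

lemma V'_ge_edge:
  assumes t: "t > 0" and x: "x \<in> X" and y: "y \<in> X"
  shows "V' t x \<ge> (1 - \<alpha>) * k x y * t powr \<mu> * Psi_term m (pressure m (u t) x) (pressure m (u t) y)"
proof -
  have "k x z * Psi_term m (pressure m (u t) x) (pressure m (u t) z) \<ge> 0" if "z \<in> X" for z
    using k_nonneg[OF x that] m u_pos[of t] t x that
    by (intro mult_nonneg_nonneg Psi_term_nonneg pressure_pos) auto
  then have "k x y * Psi_term m (pressure m (u t) x) (pressure m (u t) y) \<le> \<Psi> t x"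
    unfolding Psi_tilde_altdef using fin y by (intro member_le_sum) auto
  then have "(1 - \<alpha>) * t powr \<mu> * (k x y * Psi_term m (pressure m (u t) x) (pressure m (u t) y))
      \<le> (1 - \<alpha>) * t powr \<mu> * \<Psi> t x"
    using \<alpha> by (intro mult_left_mono) auto
  with V'_ge_Psi[OF t x] show ?thesis by (simp add: mult_ac)
qed

lemma V'_nonneg:
  assumes "t > 0" "x \<in> X"
  shows "V' t x \<ge> 0"
proof -
  \<comment> \<open>The edge bound is used with \<open>y = x\<close>; only the sign of its
    right-hand side matters.\<close>
  have "(1 - \<alpha>) * k x x * t powr \<mu> * Psi_term m (pressure m (u t) x) (pressure m (u t) x) \<ge> 0"
    using k_nonneg m \<alpha> u_pos[of t x] assms
    by (intro mult_nonneg_nonneg Psi_term_nonneg pressure_pos) auto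
  with V'_ge_edge[of t x x] assms show ?thesis by simp
qed

text \<open>Serves the case of distance zero, where no edge is available.\<close>

lemma V_mono:
  assumes "0 < s1" "s1 \<le> s2" "x \<in> X"
  shows "V s1 x \<le> V s2 x"
proof (rule DERIV_nonneg_imp_nondecreasing[where f = "\<lambda>t. V t x"])
  show "\<exists>y. ((\<lambda>t. V t x) has_real_derivative y) (at t) \<and> 0 \<le> y" if "s1 \<le> t" "t \<le> s2" for t
    using V_deriv[of t x] V'_nonneg[of t x] that assms by (intro exI[of _ "V' t x"]) simp
qed (fact assms)

text \<open>Passing from \<open>v\<close> to \<open>V = t^\<mu> v\<close> in the square produces
  \<open>t^(2 \<mu>)\<close>, so the weight \<open>t^\<mu>\<close> turns into
  \<open>t^(- \<mu>)\<close>, as the comparison of two monotone functions requires.\<close>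

lemma V'_ge_square:
  assumes t: "t > 0" and x: "x \<in> X" and y: "y \<in> X"
    and side: "m \<ge> 2 \<and> V t y \<le> V t x \<or> m \<le> 2 \<and> V t x \<le> V t y"
  shows "V' t x \<ge> (1 - \<alpha>) * k x y / 2 / t powr \<mu> * (V t x - V t y)^2"
proof -
  define v w where "v = pressure m (u t) x" and "w = pressure m (u t) y"
  have pos: "v > 0" "w > 0" using u_pos[of t] t x y m by (auto simp: v_def w_def pressure_pos)
  have "m \<ge> 2 \<and> w \<le> v \<or> m \<le> 2 \<and> v \<le> w"
    using side t by (simp add: v_def w_def)
  then have "Psi_term m v w \<ge> (v - w)^2 / 2"
    by (rule Psi_term_quadratic_bound[OF m pos])
  then have "(1 - \<alpha>) * k x y * t powr \<mu> * ((v - w)^2 / 2)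
      \<le> (1 - \<alpha>) * k x y * t powr \<mu> * Psi_term m v w"
    using \<alpha> k_nonneg[OF x y] by (intro mult_left_mono) auto
  also have "\<dots> \<le> V' t x"
    unfolding v_def w_def by (rule V'_ge_edge[OF t x y])
  also have "(1 - \<alpha>) * k x y * t powr \<mu> * ((v - w)^2 / 2)
      = (1 - \<alpha>) * k x y / 2 / t powr \<mu> * (t powr \<mu> * (v - w))^2"
    using t by (simp add: power2_eq_square)
  also have "t powr \<mu> * (v - w) = V t x - V t y"
    by (simp add: v_def w_def algebra_simps)
  finally show ?thesis .
qed

section \<open>Harnack inequalities along edges and paths\<close>

lemma edge_Harnack:
  assumes s: "0 < s1" "s1 < s2" and x: "x \<in> X" and y: "y \<in> X" and k: "k x y > 0"
  shows "V s1 x \<le> V s2 y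
    + 2 / ((1 - \<alpha>) * (\<mu> + 1) * (s2 - s1)^2) * ((s2 powr (\<mu> + 1) - s1 powr (\<mu> + 1)) / k x y)"
proof -
  define c where "c = (1 - \<alpha>) * k x y / 2"
  have c: "c > 0" using k \<alpha> by (simp add: c_def)
  have \<mu>: "\<mu> > 0" using m d by simp
  \<comment> \<open>For \<open>m \<ge> 2\<close> the growth is that of the larger value, at
    \<open>x\<close>; for \<open>m < 2\<close> it is that of the smaller value, at \<open>y\<close>,
    and symmetry of \<open>k\<close> lets the edge be read from \<open>y\<close>.\<close>
  have "(\<forall>t>0. V t y \<le> V t x \<longrightarrow> V' t x \<ge> c / t powr \<mu> * (V t x - V t y)^2) \<or>
      (\<forall>t>0. V t y \<le> V t x \<longrightarrow> V' t y \<ge> c / t powr \<mu> * (V t x - V t y)^2)"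
  proof (cases "m \<ge> 2")
    case True
    then show ?thesis using V'_ge_square[OF _ x y] by (auto simp: c_def)
  next
    case False
    then show ?thesis
      using V'_ge_square[OF _ y x] k_sym[OF x y] by (auto simp: c_def power2_commute[of "V _ x"])
  qed
  from monotone_pair_comparison[OF s c \<mu> V_deriv[OF _ x] V_deriv[OF _ y]
      V'_nonneg[OF _ x] V'_nonneg[OF _ y] this]
  have "V s1 x \<le> V s2 y + (s2 powr (\<mu> + 1) - s1 powr (\<mu> + 1)) / ((\<mu> + 1) * c * (s2 - s1)^2)" .
  also have "(s2 powr (\<mu> + 1) - s1 powr (\<mu> + 1)) / ((\<mu> + 1) * c * (s2 - s1)^2)
      = 2 / ((1 - \<alpha>) * (\<mu> + 1) * (s2 - s1)^2) * ((s2 powr (\<mu> + 1) - s1 powr (\<mu> + 1)) / k x y)"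
    by (simp add: c_def mult_ac)
  finally show ?thesis .
qed

text \<open>Induction on the number of edges, each given a time interval of the same length
  \<open>h\<close>, so that all edges share one constant. With \<open>s\<close> and \<open>h\<close>
  as parameters the step length stays fixed when \<open>N\<close> grows.\<close>

lemma path_Harnack:
  fixes y :: "nat \<Rightarrow> 'a" and N :: nat
  assumes s: "0 < s" and h: "0 < h"
    and y: "\<forall>i\<le>N. y i \<in> X" and k: "\<forall>i<N. k (y i) (y (Suc i)) > 0"
  shows "V s (y 0) \<le> V (s + real N * h) (y N) + 2 / ((1 - \<alpha>) * (\<mu> + 1) * h^2) *
    (\<Sum>j<N. ((s + real (Suc j) * h) powr (\<mu> + 1) - (s + real j * h) powr (\<mu> + 1))
      / k (y j) (y (Suc j)))"
  using y k
proof (induction N)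
  case 0
  then show ?case by simp
next
  case (Suc N)
  have "s + real N * h > 0" using s h by (simp add: add_pos_nonneg)
  moreover have "s + real N * h < s + real (Suc N) * h" using h by simp
  moreover have "s + real (Suc N) * h - (s + real N * h) = h" by (simp add: algebra_simps)
  ultimately have "V (s + real N * h) (y N) \<le> V (s + real (Suc N) * h) (y (Suc N))
      + 2 / ((1 - \<alpha>) * (\<mu> + 1) * h^2) *
        (((s + real (Suc N) * h) powr (\<mu> + 1) - (s + real N * h) powr (\<mu> + 1))
          / k (y N) (y (Suc N)))"
    using edge_Harnack[of "s + real N * h" "s + real (Suc N) * h" "y N" "y (Suc N)"] Suc.prems
    by simp
  moreover have "V s (y 0) \<le> V (s + real N * h) (y N) + 2 / ((1 - \<alpha>) * (\<mu> + 1) * h^2) *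
    (\<Sum>j<N. ((s + real (Suc j) * h) powr (\<mu> + 1) - (s + real j * h) powr (\<mu> + 1))
      / k (y j) (y (Suc j)))"
    using Suc by simp
  ultimately show ?case
    unfolding sum.lessThan_Suc distrib_left by linarith
qed

lemma Harnack:
  fixes y :: "nat \<Rightarrow> 'a" and N :: nat
  assumes t: "0 < t1" "t1 < t2" and N: "N \<ge> 1"
    and y: "\<forall>i\<le>N. y i \<in> X" and k: "\<forall>i<N. k (y i) (y (Suc i)) > 0"
    and \<tau>: "\<And>i. \<tau> i = t1 + real i * ((t2 - t1) / real N)"
  shows "V t1 (y 0) \<le> V t2 (y N) + 2 * (real N)^2 / ((1 - \<alpha>) * (\<mu> + 1) * (t2 - t1)^2) *
    (\<Sum>j<N. (\<tau> (Suc j) powr (\<mu> + 1) - \<tau> j powr (\<mu> + 1)) / k (y j) (y (Suc j)))"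
proof -
  define h where "h = (t2 - t1) / real N"
  have h: "h > 0" "t1 + real N * h = t2" using t N by (auto simp: h_def)
  have "2 / ((1 - \<alpha>) * (\<mu> + 1) * h^2) = 2 * (real N)^2 / ((1 - \<alpha>) * (\<mu> + 1) * (t2 - t1)^2)"
    by (simp add: h_def power_divide)
  with path_Harnack[OF t(1) h(1) y k] h(2) show ?thesis
    unfolding \<tau> h_def[symmetric] by simp
qed

end

section \<open>Paths in the induced graph\<close>

lemma induced_graph_simps [simp]:
  "verts (induced_graph X k) = X"
  "arcs (induced_graph X k) = {(x, y). x \<in> X \<and> y \<in> X \<and> k x y > 0}"
  "tail (induced_graph X k) = fst"
  "head (induced_graph X k) = snd"
  by (simp_all add: induced_graph_def)

lemma wf_induced_graph: "wf_digraph (induced_graph X k)"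
  by unfold_locales auto

text \<open>The minimum in \<open>graph_dist\<close> is attained: a connected symmetric digraph is
  strongly connected, so some simple path joins the two vertices.\<close>

lemma induced_graph_dist_path:
  assumes sym: "\<forall>x\<in>X. \<forall>y\<in>X. k x y = k y x"
    and conn: "Digraph_Component.connected (induced_graph X k)"
    and x: "x \<in> X" and z: "z \<in> X"
  shows "\<exists>p. pre_digraph.apath (induced_graph X k) x p z \<and> length p = graph_dist X k x z"
proof -
  interpret wf_digraph "induced_graph X k" by (rule wf_induced_graph)
  have "symmetric (induced_graph X k)"
    unfolding symmetric_conv using sym by auto
  then have "strongly_connected (induced_graph X k)"
    using conn by (rule symmetric_connected_imp_strongly_connected)
  then have "\<exists>n p. apath x p z \<and> length p = n"
    using x z by (auto simp: strongly_connected_def reachable_apath)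
  then show ?thesis
    unfolding graph_dist_def by (rule LeastI_ex)
qed

text \<open>Passes from arc lists, the form of walks in the graph library, to the sequences of
  vertices used in the Harnack inequality.\<close>

lemma induced_graph_walk_sequence:
  assumes "pre_digraph.awalk (induced_graph X k) x p z"
  shows "\<exists>y. y 0 = x \<and> y (length p) = z \<and> (\<forall>i\<le>length p. y i \<in> X) \<and>
    (\<forall>i<length p. k (y i) (y (Suc i)) > 0)"
  using assms
proof (induction p arbitrary: x)
  case Nil
  then show ?case
    by (auto simp: pre_digraph.awalk_def pre_digraph.cas.simps intro!: exI[of _ "\<lambda>_. x"])
next
  case (Cons e p)
  then have e: "x = fst e" "x \<in> X" "k x (snd e) > 0"
    and "pre_digraph.awalk (induced_graph X k) (snd e) p z"
    by (auto simp: pre_digraph.awalk_def pre_digraph.cas.simps)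
  from Cons.IH[OF this(4)] obtain y where y: "y 0 = snd e" "y (length p) = z"
    "\<forall>i\<le>length p. y i \<in> X" "\<forall>i<length p. k (y i) (y (Suc i)) > 0" by blast
  show ?case
    using e y by (intro exI[of _ "case_nat x y"]) (auto split: nat.split)
qed

theorem corollary6p5:
  fixes X :: "'a set" and k :: "'a \<Rightarrow> 'a \<Rightarrow> real"
    and u v :: "real \<Rightarrow> 'a \<Rightarrow> real"
    and m \<alpha> d \<mu> t1 t2 :: real and x1 x2 :: 'a
  assumes "m > 1"
    and "finite X" and "X \<noteq> {}"
    and "\<forall>x\<in>X. \<forall>y\<in>X. k x y \<ge> 0"
    and "\<forall>x\<in>X. \<forall>y\<in>X. k x y = k y x"
    and "\<forall>x\<in>X. k x x = 0"
    and "\<exists>x\<in>X. \<exists>y\<in>X. k x y \<noteq> 0"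
    and "Digraph_Component.connected (induced_graph X k)"
    and "d > 0" and "0 \<le> \<alpha>" and "\<alpha> < 1"
    and "CD X k m \<alpha> d"
    and "pme_solution X k m u"
    and "\<forall>t\<ge>0. \<forall>x\<in>X. v t x = pressure m (u t) x"
    and "\<mu> = (m - 1) * d"
    and "0 < t1" and "t1 < t2"
    and "x1 \<in> X" and "x2 \<in> X"
  shows "(\<forall>(N::nat) (y::nat \<Rightarrow> 'a).
            N \<ge> 1 \<and> (\<forall>i\<in>{0..N}. y i \<in> X) \<and> inj_on y {0..N} \<and> y 0 = x1 \<and> y N = x2
            \<and> (\<forall>i\<in>{1..N}. k (y (i - 1)) (y i) > 0) \<longrightarrow>
            (let \<tau> = (\<lambda>i::nat. t1 + real i * ((t2 - t1) / real N)) in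
              t1 powr \<mu> * v t1 x1 \<le> t2 powr \<mu> * v t2 x2
                + 2 * (real N)^2 / ((1 - \<alpha>) * (\<mu> + 1) * (t2 - t1)^2)
                  * (\<Sum>j = 1..N. (\<tau> j powr (\<mu> + 1) - \<tau> (j - 1) powr (\<mu> + 1))
                                  / k (y (j - 1)) (y j))))
       \<and> t1 powr \<mu> * v t1 x1 \<le> t2 powr \<mu> * v t2 x2
           + 2 * (real (graph_dist X k x1 x2))^2 * (t2 powr (\<mu> + 1) - t1 powr (\<mu> + 1))
             / ((1 - \<alpha>) * (\<mu> + 1) * min_weight X k * (t2 - t1)^2)"
    (is "?along_paths \<and> ?distance_bound")
proof
  interpret CD_flow X k m \<alpha> d u
    using assms by unfold_locales auto
  have \<mu>: "\<mu> = (m - 1) * d" "\<mu> > 0" using assms by simp_all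
  have v: "v t1 x = pressure m (u t1) x" "v t2 x = pressure m (u t2) x" if "x \<in> X" for x
    using assms that by simp_all
  note Harnack_v = Harnack[OF \<open>0 < t1\<close> \<open>t1 < t2\<close>, folded \<mu>(1)]
  show ?along_paths
  proof (intro allI impI, unfold Let_def)
    fix N :: nat and y :: "nat \<Rightarrow> 'a"
    assume y: "N \<ge> 1 \<and> (\<forall>i\<in>{0..N}. y i \<in> X) \<and> inj_on y {0..N} \<and> y 0 = x1 \<and> y N = x2
            \<and> (\<forall>i\<in>{1..N}. k (y (i - 1)) (y i) > 0)"
    define \<tau> where "\<tau> = (\<lambda>i::nat. t1 + real i * ((t2 - t1) / real N))"
    have "k (y i) (y (Suc i)) > 0" if "i < N" for i
      using y that by (auto dest!: bspec[of _ _ "Suc i"])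
    then have "t1 powr \<mu> * pressure m (u t1) (y 0) \<le> t2 powr \<mu> * pressure m (u t2) (y N)
        + 2 * (real N)^2 / ((1 - \<alpha>) * (\<mu> + 1) * (t2 - t1)^2)
          * (\<Sum>j<N. (\<tau> (Suc j) powr (\<mu> + 1) - \<tau> j powr (\<mu> + 1)) / k (y j) (y (Suc j)))"
      using y by (intro Harnack_v) (auto simp: \<tau>_def)
    also have "(\<Sum>j<N. (\<tau> (Suc j) powr (\<mu> + 1) - \<tau> j powr (\<mu> + 1)) / k (y j) (y (Suc j)))
        = (\<Sum>j = 1..N. (\<tau> j powr (\<mu> + 1) - \<tau> (j - 1) powr (\<mu> + 1)) / k (y (j - 1)) (y j))"
      by (rule sum.reindex_bij_witness[of _ "\<lambda>j. j - 1" Suc]) auto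
    finally show "t1 powr \<mu> * v t1 x1 \<le> t2 powr \<mu> * v t2 x2
        + 2 * (real N)^2 / ((1 - \<alpha>) * (\<mu> + 1) * (t2 - t1)^2)
          * (\<Sum>j = 1..N. ((t1 + real j * ((t2 - t1) / real N)) powr (\<mu> + 1)
              - (t1 + real (j - 1) * ((t2 - t1) / real N)) powr (\<mu> + 1)) / k (y (j - 1)) (y j))"
      unfolding \<tau>_def using v \<open>x1 \<in> X\<close> \<open>x2 \<in> X\<close> y by simp
  qed
  show ?distance_bound
  proof -
    obtain p where p: "pre_digraph.apath (induced_graph X k) x1 p x2"
      "length p = graph_dist X k x1 x2"
      using induced_graph_dist_path[OF assms(5,8) \<open>x1 \<in> X\<close> \<open>x2 \<in> X\<close>] by blast
    define N where "N = graph_dist X k x1 x2"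
    have "pre_digraph.awalk (induced_graph X k) x1 p x2"
      using p(1) by (simp add: pre_digraph.apath_def)
    from induced_graph_walk_sequence[OF this] obtain y where y: "y 0 = x1" "y N = x2"
      "\<forall>i\<le>N. y i \<in> X" "\<forall>i<N. k (y i) (y (Suc i)) > 0"
      unfolding N_def p(2)[symmetric] by blast
    show ?thesis
    proof (cases "N = 0")
      case True
      \<comment> \<open>The error term vanishes at distance zero, and monotonicity in time
        remains.\<close>
      then have "x1 = x2" using y by simp
      then have "t1 powr \<mu> * v t1 x1 \<le> t2 powr \<mu> * v t2 x2"
        using V_mono[of t1 t2 x1] assms(16-18) v \<mu>(1) by simp
      with True show ?thesis
        unfolding N_def[symmetric] by simp
    next
      case False
      define \<tau> where "\<tau> = (\<lambda>i::nat. t1 + real i * ((t2 - t1) / real N))"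
      define W where "W = {k x y | x y. x \<in> X \<and> y \<in> X \<and> k x y > 0}"
      have "W \<subseteq> (\<lambda>(x, y). k x y) ` (X \<times> X)" by (auto simp: W_def)
      then have fin_W: "finite W" using \<open>finite X\<close> by (meson finite_SigmaI finite_imageI finite_subset)
      have in_W: "k (y j) (y (Suc j)) \<in> W" if "j < N" for j
        unfolding W_def using y(3,4) that by (metis (mono_tags, lifting) Suc_leI less_imp_le mem_Collect_eq)
      \<comment> \<open>The first edge of the path witnesses that \<open>W\<close> is nonempty, so
        the minimal weight is attained and hence positive.\<close>
      have "Min W \<in> W" using in_W[of 0] False fin_W by (intro Min_in) auto
      then have W_pos: "Min W > 0" by (auto simp: W_def)
      have \<tau>_mono: "\<tau> j \<le> \<tau> (Suc j)" "\<tau> j > 0" for j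
        using \<open>0 < t1\<close> \<open>t1 < t2\<close>
        by (auto simp: \<tau>_def intro!: divide_right_mono mult_right_mono add_pos_nonneg)
      define C where "C = 2 * (real N)^2 / ((1 - \<alpha>) * (\<mu> + 1) * (t2 - t1)^2)"
      define S where
        "S = (\<Sum>j<N. (\<tau> (Suc j) powr (\<mu> + 1) - \<tau> j powr (\<mu> + 1)) / k (y j) (y (Suc j)))"
      have "C \<ge> 0" using \<open>\<alpha> < 1\<close> \<mu>(2) by (simp add: C_def)
      \<comment> \<open>With every weight replaced by the minimal one, the sum telescopes from
        \<open>\<tau> 0 = t1\<close> to \<open>\<tau> N = t2\<close>.\<close>
      have "S \<le> (\<Sum>j<N. (\<tau> (Suc j) powr (\<mu> + 1) - \<tau> j powr (\<mu> + 1)) / Min W)"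
        unfolding S_def
      proof (intro sum_mono divide_left_mono)
        fix j assume "j \<in> {..<N}"
        then have j: "j < N" by simp
        show "Min W \<le> k (y j) (y (Suc j))" using fin_W in_W[OF j] by (rule Min_le)
        show "0 \<le> \<tau> (Suc j) powr (\<mu> + 1) - \<tau> j powr (\<mu> + 1)"
          using \<tau>_mono[of j] \<mu>(2) by (simp add: powr_mono2)
        show "0 < k (y j) (y (Suc j)) * Min W" using W_pos y(4) j by simp
      qed
      also have "\<dots> = (t2 powr (\<mu> + 1) - t1 powr (\<mu> + 1)) / Min W"
        unfolding sum_divide_distrib[symmetric]
          sum_lessThan_telescope[of "\<lambda>j. \<tau> j powr (\<mu> + 1)"]
        using False by (simp add: \<tau>_def)
      finally have "C * S \<le> C * ((t2 powr (\<mu> + 1) - t1 powr (\<mu> + 1)) / Min W)"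
        using \<open>C \<ge> 0\<close> by (rule mult_left_mono)
      moreover have "t1 powr \<mu> * pressure m (u t1) (y 0)
          \<le> t2 powr \<mu> * pressure m (u t2) (y N) + C * S"
        unfolding C_def S_def using y False by (intro Harnack_v) (auto simp: \<tau>_def)
      moreover have "C * ((t2 powr (\<mu> + 1) - t1 powr (\<mu> + 1)) / Min W)
          = 2 * (real N)^2 * (t2 powr (\<mu> + 1) - t1 powr (\<mu> + 1))
             / ((1 - \<alpha>) * (\<mu> + 1) * Min W * (t2 - t1)^2)"
        by (simp add: C_def mult_ac)
      ultimately show ?thesis
        using v[OF \<open>x1 \<in> X\<close>] v[OF \<open>x2 \<in> X\<close>] y(1,2)
        unfolding N_def[symmetric] min_weight_def W_def[symmetric] by simp
    qed
  qed
qed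

end
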